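(* Let $\tau>0$ and let $\mathbf{A},\mathbf{B}\in\mathbb{R}^{2\times 2}$ be of the form $$\mathbf{A}=\begin{bmatrix}0&1\\ a_{21}&a_{22}\end{bmatrix},\qquad \mathbf{B}=\begin{bmatrix}0&0\\ b_{21}&b_{22}\end{bmatrix}.$$ Suppose that all characteristic roots of the system $\dot{\mathbf{x}}(t)=\mathbf{A}\mathbf{x}(t)+\mathbf{B}\mathbf{x}(t-\tau)$ are simple and that the number of real characteristic roots is different from one. Then all characteristic roots can be found using only the two branches $k=0$ and $k=-1$ of the matrix Lambert W function, and with real solutions only; that is, for every characteristic root $\lambda$ there exist $k\in\{0,-1\}$ and a real matrix $\mathbf{M}_k\in\mathbb{R}^{2\times2}$, of the form $\mathbf{M}_k=\tau\mathbf{B}\mathbf{Q}_k$ for some matrix $\mathbf{Q}_k$, such that $$\mathbf{W}_k(\mathbf{M}_k)\exp\left(\mathbf{W}_k(\mathbf{M}_k)+\mathbf{A}\tau\right)-\tau\mathbf{B}=\mathbf{0}$$ and $\lambda$ is an eigenvalue of $$\mathbf{S}_k=\frac1\tau\mathbf{W}_k(\mathbf{M}_k)+\mathbf{A}.$$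
   Context: Characteristic roots of $\dot{\mathbf{x}}(t)=\mathbf{A}\mathbf{x}(t)+\mathbf{B}\mathbf{x}(t-\tau)$ are the complex zeros $s$ of $\det(s\mathbf{I}-\mathbf{A}-\mathbf{B}e^{-s\tau})$; a root is simple if it is a simple zero of this function. Scalar Lambert W function: for $z\in\mathbb{C}$, the multivalued function $W(z)$ is defined by $W(z)e^{W(z)}=z$; $W_k(z)$, $k\in\mathbb{Z}$, denotes its $k$-th branch with the standard branch cuts of Corless et al. (1996). For real arguments, the only real-valued branches are: $W_0$, real on $[-1/e,\infty)$ with range $[-1,\infty)$; and $W_{-1}$, real on $[-1/e,0)$ with range $(-\infty,-1]$. Moreover $W_0(0)=0$, $W_0'(0)=1$, and $W_k(0)=\infty$ for $k\neq0$. Matrix Lambert W function (with the "hybrid branch" convention): let $\mathbf{H}\in\mathbb{C}^{n\times n}$ have Jordan decomposition $\mathbf{H}=\mathbf{Z}\,\mathrm{diag}(\mathbf{J}_1(\lambda_1),\dots,\mathbf{J}_p(\lambda_p))\,\mathbf{Z}^{-1}$ (here the $\lambda_i$ denote eigenvalues of $\mathbf{H}$). Then $\mathbf{W}_k(\mathbf{H})=\mathbf{Z}\,\mathrm{diag}(\mathbf{W}_k(\mathbf{J}_1(\lambda_1)),\dots,\mathbf{W}_k(\mathbf{J}_p(\lambda_p)))\,\mathbf{Z}^{-1}$, where for a Jordan block $\mathbf{J}_i(\lambda_i)$ of size $m$ with $\lambda_i\ne0$, $\mathbf{W}_k(\mathbf{J}_i(\lambda_i))$ is the $m\times m$ upper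 triangular Toeplitz matrix whose entry on the $j$-th superdiagonal is $\frac{1}{j!}W_k^{(j)}(\lambda_i)$, $j=0,\dots,m-1$; and for blocks with $\lambda_i=0$ the same formula is used with the branch $k$ replaced by $0$ (whatever the value of $k$). When $k=0$ it is assumed that $-e^{-1}$ is not an eigenvalue of $\mathbf{H}$ belonging to a Jordan block of size larger than 1 (since $W_0'(-e^{-1})$ is undefined). $\exp$ denotes the matrix exponential. *)

theory Defs
  imports
    "HOL-Complex_Analysis.Complex_Analysis"
    "Jordan_Normal_Form.Jordan_Normal_Form_Existence"
begin

abbreviation cmat :: "real mat \<Rightarrow> complex mat" where
  "cmat \<equiv> map_mat complex_of_real"

section \<open>Characteristic roots of a delay system with one discrete delay\<close>

definition char_fun :: "real mat \<Rightarrow> real mat \<Rightarrow> real \<Rightarrow> complex \<Rightarrow> complex" where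
  "char_fun A B \<tau> s =
     Determinant.det (s \<cdot>\<^sub>m 1\<^sub>m (dim_row A) - cmat A - exp (- s * complex_of_real \<tau>) \<cdot>\<^sub>m cmat B)"

definition char_root :: "real mat \<Rightarrow> real mat \<Rightarrow> real \<Rightarrow> complex \<Rightarrow> bool" where
  "char_root A B \<tau> s \<longleftrightarrow> char_fun A B \<tau> s = 0"

definition simple_char_root :: "real mat \<Rightarrow> real mat \<Rightarrow> real \<Rightarrow> complex \<Rightarrow> bool" where
  "simple_char_root A B \<tau> s \<longleftrightarrow> char_root A B \<tau> s \<and> zorder (char_fun A B \<tau>) s = 1"

section \<open>Scalar Lambert W function\<close>

text \<open>
  Ranges of the branches, following Corless et al.  The separating curves in the
  \<open>w\<close>-plane are the preimages of the negative real axis under \<open>w \<mapsto> w * exp w\<close>.  Since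
  \<open>Im w + Arg w\<close> is an unwrapped argument of \<open>w * exp w\<close>, these curves are where it is an odd
  multiple of \<open>pi\<close>; for instance \<open>w = - \<eta> * cot \<eta> + \<i> * \<eta>\<close> with \<open>0 < \<eta> < pi\<close> has
  \<open>Arg w = pi - \<eta>\<close>, so that the sum is \<open>pi\<close>.  Closing each strip at the top is the
  counter-clockwise continuity convention: on a cut a branch takes its limit from above.
  The exception is the negative real \<open>w\<close>-axis, where the sum is \<open>pi\<close> throughout:
  its part up to \<open>-1\<close> separates branches \<open>-1\<close> and \<open>1\<close> and belongs to branch \<open>-1\<close>, and
  the point \<open>-1\<close> is a value of both branch \<open>0\<close> and branch \<open>-1\<close>.
\<close>

definition lambert_W_range :: "int \<Rightarrow> complex set" where
  "lambert_W_range k =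
     (let strip = {w. (2 * of_int k - 1) * pi < Im w + Arg w \<and> Im w + Arg w \<le> (2 * of_int k + 1) * pi}
      in if k = 0 then strip - {w. Im w = 0 \<and> Re w < -1}
         else if k = -1 then strip \<union> {w. Im w = 0 \<and> Re w \<le> -1}
         else strip)"

text \<open>The value is unspecified for \<open>z = 0\<close> and \<open>k \<noteq> 0\<close>, where the branch is infinite.\<close>

definition lambert_W :: "int \<Rightarrow> complex \<Rightarrow> complex" where
  "lambert_W k z = (THE w. w \<in> lambert_W_range k \<and> w * exp w = z)"

text \<open>
  The branch cuts of \<open>W\<^sub>k\<close> contain real points at which its derivatives are nevertheless needed
  (for instance all of \<open>(- 1/e, 0)\<close> for \<open>k = -1\<close>), although \<open>W\<^sub>k\<close> is discontinuous there as a
  function on the complex plane.  The derivatives of \<open>W\<^sub>k\<close> at \<open>z\<close> are therefore those of the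
  holomorphic local inverse of \<open>w \<mapsto> w * exp w\<close> through \<open>W\<^sub>k(z)\<close>, as obtained by implicit
  differentiation.  Its germ is unique, it agrees with \<open>W\<^sub>k\<close> near \<open>z\<close> off the cuts, and it
  exists unless \<open>W\<^sub>k(z) = -1\<close>.
\<close>

definition lambert_W_germ :: "int \<Rightarrow> complex \<Rightarrow> complex \<Rightarrow> complex" where
  "lambert_W_germ k z =
     (SOME g. \<exists>U. open U \<and> z \<in> U \<and> g holomorphic_on U \<and> g z = lambert_W k z \<and>
                  (\<forall>u\<in>U. g u * exp (g u) = u))"

text \<open>Order \<open>0\<close> is separate because \<open>W\<^sub>k(z)\<close> is also needed where there is no germ.\<close>

definition lambert_W_deriv :: "int \<Rightarrow> nat \<Rightarrow> complex \<Rightarrow> complex" where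
  "lambert_W_deriv k j z =
     (if j = 0 then lambert_W k z else (deriv ^^ j) (lambert_W_germ k z) z)"

section \<open>Matrix Lambert W function with the hybrid branch convention\<close>

definition lambert_W_jordan_block :: "int \<Rightarrow> nat \<Rightarrow> complex \<Rightarrow> complex mat" where
  "lambert_W_jordan_block k m a =
     mat m m (\<lambda>(i, j). if i \<le> j
       then lambert_W_deriv (if a = 0 then 0 else k) (j - i) a / fact (j - i) else 0)"

text \<open>
  A Jordan decomposition of \<open>H\<close> with \<open>H = Z * jordan_matrix n_as * Zi\<close>, where \<open>Zi\<close> is the
  inverse of \<open>Z\<close> and \<open>n_as\<close> lists the sizes and eigenvalues of the blocks.
\<close>

definition jordan_decomposition ::
    "complex mat \<Rightarrow> complex mat \<times> complex mat \<times> (nat \<times> complex) list \<Rightarrow> bool" where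
  "jordan_decomposition H = (\<lambda>(Z, Zi, n_as).
     0 \<notin> fst ` set n_as \<and> similar_mat_wit H (jordan_matrix n_as) Z Zi)"

definition matrix_lambert_W :: "int \<Rightarrow> complex mat \<Rightarrow> complex mat" where
  "matrix_lambert_W k H =
     (case (SOME D. jordan_decomposition H D) of (Z, Zi, n_as) \<Rightarrow>
        Z * diag_block_mat (map (\<lambda>(m, a). lambert_W_jordan_block k m a) n_as) * Zi)"

text \<open>
  The derivatives of \<open>W\<^sub>k\<close> are undefined at the branch point \<open>- 1/e\<close> for \<open>k = 0\<close>, and equally for
  \<open>k = -1\<close>, since both branches take the value \<open>-1\<close> there.
\<close>

definition matrix_lambert_W_defined :: "int \<Rightarrow> complex mat \<Rightarrow> bool" where
  "matrix_lambert_W_defined k H \<longleftrightarrow>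
     (k \<in> {0, -1} \<longrightarrow>
       (\<forall>n_as m. jordan_nf H n_as \<and> (m, - exp (-1)) \<in> set n_as \<longrightarrow> m \<le> 1))"

section \<open>Matrix exponential\<close>

definition mat_exp :: "complex mat \<Rightarrow> complex mat" where
  "mat_exp X = mat (dim_row X) (dim_row X) (\<lambda>(i, j). \<Sum>m. (X ^\<^sub>m m) $$ (i, j) / fact m)"

end

theory Submission
  imports Defs
begin

text \<open>
  A real companion matrix \<open>S\<close> with distinct eigenvalues \<open>\<mu>\<close> and \<open>\<nu>\<close> has the eigenvectors \<open>(1, \<mu>)\<close>
  and \<open>(1, \<nu>)\<close>.  Applied to them, the matrix equation \<open>S = A + B * exp (- \<tau> * S)\<close> says precisely
  that \<open>\<mu>\<close> and \<open>\<nu>\<close> are characteristic roots, because the top rows on the two sides always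
  agree.  So every pair of distinct characteristic roots with real sum and product
  yields a real solution \<open>S\<close>.  Each root belongs to such a pair: a nonreal one together with its
  conjugate, a real one together with a second real root (lemma \<open>second_root\<close>).

  Put \<open>W = \<tau> * (S - A)\<close>.  The equation for \<open>S\<close> becomes \<open>W * exp (W + \<tau> * A) = \<tau> * B\<close>
  (lemma \<open>bottom_row_mult_exp_companion\<close>).  It remains to see that \<open>W\<close> is a value of the matrix
  Lambert W function on one of the branches \<open>0\<close> and \<open>-1\<close>.  Only the bottom row \<open>(w1, w2)\<close> of \<open>W\<close>
  is nonzero, and it is real.  The obvious argument is \<open>M = exp w2 * W\<close>, whose nonzero
  eigenvalue, if it has one, is \<open>w2 * exp w2\<close>.  As \<open>M\<close> has rank at most one, the value of the
  matrix function at \<open>M\<close> is a multiple of \<open>M\<close>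
  (lemma \<open>matrix_lambert_W_eq_smult\<close>), namely \<open>exp (- w2) * M = W\<close> as soon as the scalar branch
  maps \<open>w2 * exp w2\<close> back to \<open>w2\<close>.  For real \<open>w2\<close> this holds on branch \<open>0\<close> if \<open>w2 \<ge> -1\<close> and on
  branch \<open>-1\<close> if \<open>w2 \<le> -1\<close> (lemmas \<open>lambert_W_0_real\<close> and \<open>lambert_W_m1_real\<close>), which covers
  all cases.
\<close>

section \<open>The real branches of the scalar Lambert W function\<close>

lemma deriv_x_exp: "((\<lambda>x::real. x * exp x) has_real_derivative (1 + x) * exp x) (at x)"
  by (auto intro!: derivative_eq_intros simp: algebra_simps)

text \<open>
  The derivative of \<open>x * exp x\<close> is \<open>(1 + x) * exp x\<close>, so the two real branches are the
  inverses of its restrictions to the two sides of its only critical point \<open>-1\<close>.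
\<close>

lemma x_exp_x_inj_ge:
  assumes "-1 \<le> x" "-1 \<le> y" "x * exp x = y * exp (y::real)"
  shows "x = y"
proof -
  have less: "a * exp a < b * exp b" if "-1 \<le> a" "a < b" for a b :: real
  proof (rule DERIV_pos_imp_increasing_open[OF that(2)])
    show "\<exists>y. ((\<lambda>x. x * exp x) has_real_derivative y) (at x) \<and> 0 < y" if "a < x" "x < b" for x
      using deriv_x_exp[of x] that \<open>-1 \<le> a\<close> by (intro exI conjI) auto
  qed (intro continuous_intros)
  show ?thesis using less[of x y] less[of y x] assms by (cases x y rule: linorder_cases) auto
qed

lemma x_exp_x_inj_le:
  assumes "x \<le> -1" "y \<le> -1" "x * exp x = y * exp (y::real)"
  shows "x = y"
proof -
  have less: "a * exp a > b * exp b" if "b \<le> -1" "a < b" for a b :: real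
  proof (rule DERIV_neg_imp_decreasing_open[OF that(2)])
    show "\<exists>y. ((\<lambda>x. x * exp x) has_real_derivative y) (at x) \<and> y < 0" if "a < x" "x < b" for x
      using deriv_x_exp[of x] that \<open>b \<le> -1\<close> by (intro exI conjI) (auto intro!: mult_neg_pos)
  qed (intro continuous_intros)
  show ?thesis using less[of x y] less[of y x] assms by (cases x y rule: linorder_cases) auto
qed

lemma x_exp_x_ge: "- exp (-1) \<le> x * exp (x::real)"
proof -
  have "1 + (- 1 - x) \<le> exp (- 1 - x)" by (rule exp_ge_add_one_self)
  hence "(- x) * exp x \<le> exp (- 1 - x) * exp x" by (intro mult_right_mono) auto
  thus ?thesis by (simp flip: exp_add)
qed

lemma x_cos_less_sin:
  assumes "0 < y" "y < pi"
  shows "y * cos y < sin (y::real)"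
proof -
  have "0 * cos 0 - sin 0 > y * cos y - sin y"
  proof (rule DERIV_neg_imp_decreasing_open[OF assms(1)])
    show "\<exists>d. ((\<lambda>y. y * cos y - sin y) has_real_derivative d) (at x) \<and> d < 0" if "0 < x" "x < y" for x
    proof (intro exI conjI)
      show "((\<lambda>y. y * cos y - sin y) has_real_derivative - (x * sin x)) (at x)"
        by (auto intro!: derivative_eq_intros)
      show "- (x * sin x) < 0" using that assms sin_gt_zero[of x] by simp
    qed
  qed (intro continuous_intros)
  thus ?thesis by simp
qed

text \<open>
  This makes \<open>Im w + Arg w\<close>, the quantity that delimits the branch ranges, an argument
  of \<open>w * exp w\<close>.
\<close>

lemma w_exp_w_polar:
  "w * exp w = rcis (norm w * exp (Re w)) (Im w + Arg w)"
proof -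
  have "w = rcis (norm w) (Arg w)" by (simp add: rcis_cmod_Arg)
  moreover have "exp w = rcis (exp (Re w)) (Im w)" by (simp add: exp_eq_polar rcis_def)
  ultimately have "w * exp w = rcis (norm w) (Arg w) * rcis (exp (Re w)) (Im w)" by simp
  thus ?thesis by (simp add: rcis_mult add.commute)
qed

text \<open>
  Nonreal points of the curves that separate the branches \<open>0\<close> and \<open>\<plusminus>1\<close> are mapped into the
  cut \<open>(-\<infinity>, - 1/e)\<close>, so they never compete with the real values of a branch on
  \<open>[- 1/e, \<infinity>)\<close>.  On the upper curve \<open>w = - y * cot y + \<i> * y\<close> with \<open>0 < y < pi\<close>, hence
  \<open>norm w = y / sin y \<ge> 1\<close> and \<open>Re w > -1\<close>, and the image is \<open>- norm w * exp (Re w)\<close>.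
\<close>

lemma cut_preimage_upper:
  assumes "Im w > 0" "Im w + Arg w = pi"
  shows "Re (w * exp w) < - exp (-1)"
proof -
  define y where "y = Im w"
  have Arg: "Arg w = pi - y" using assms(2) by (simp add: y_def)
  have y: "0 < y" "y < pi" using assms(1) Arg Arg_lt_pi[of w] by (auto simp: y_def)
  have s: "sin y > 0" by (rule sin_gt_zero[OF y])
  have wp: "w = rcis (norm w) (pi - y)" using rcis_cmod_Arg[of w] Arg by simp
  have im: "norm w * sin y = y" and re: "Re w = - (norm w * cos y)"
    using arg_cong[OF wp, of Im] arg_cong[OF wp, of Re] by (auto simp: y_def[symmetric])
  have r: "norm w \<ge> 1"
  proof (rule ccontr)
    assume "\<not> norm w \<ge> 1"
    hence "norm w * sin y < 1 * sin y" using s by (intro mult_strict_right_mono) auto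
    thus False using im sin_x_le_x[of y] y by simp
  qed
  have "norm w * cos y * sin y < 1 * sin y"
    using x_cos_less_sin[OF y] im by (simp add: mult_ac) (metis mult.assoc mult.commute)
  hence "-1 < Re w" using re s mult_less_cancel_right_pos[OF s] by simp
  hence "exp (-1) < exp (Re w)" by simp
  also have "\<dots> \<le> norm w * exp (Re w)" using r by simp
  finally show ?thesis by (simp add: w_exp_w_polar assms(2) rcis_def del: minus_add_distrib)
qed

lemma cut_preimage:
  assumes "Im w \<noteq> 0" "\<bar>Im w + Arg w\<bar> = pi"
  shows "Re (w * exp w) < - exp (-1)"
proof (cases "Im w > 0")
  case True
  thus ?thesis using assms cut_preimage_upper[of w] Arg_lt_pi[of w] by auto
next
  case False
  hence *: "Im w < 0" using assms by simp
  hence "Arg w < 0" using Arg_neg_iff by blast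
  moreover have "w \<notin> \<real>" using assms by (simp add: complex_is_Real_iff)
  ultimately have "Im (cnj w) + Arg (cnj w) = pi" using * assms(2) by (simp add: Arg_cnj)
  hence "Re (cnj w * exp (cnj w)) < - exp (-1)" using * by (intro cut_preimage_upper) auto
  moreover have "cnj w * exp (cnj w) = cnj (w * exp w)" by (simp add: exp_cnj)
  ultimately show ?thesis by simp
qed

text \<open>
  An even multiple of \<open>pi\<close> is the argument of a positive number.
\<close>

lemma real_preimage_unwrapped_arg:
  assumes "w * exp w = complex_of_real m" "w \<noteq> 0"
  obtains i :: int where "Im w + Arg w = of_int i * pi" "even i \<Longrightarrow> m > 0"
proof -
  have "norm w * exp (Re w) * sin (Im w + Arg w) = 0"
    using arg_cong[OF assms(1), of Im] unfolding w_exp_w_polar by simp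
  hence "sin (Im w + Arg w) = 0" using assms by simp
  then obtain i :: int where i: "Im w + Arg w = of_int i * pi" by (auto simp: sin_zero_iff_int2)
  have m: "m = norm w * exp (Re w) * cos (of_int i * pi)"
    using arg_cong[OF assms(1), of Re] unfolding w_exp_w_polar i by simp
  have "m > 0" if "even i"
    using that m assms by (auto elim!: evenE simp: mult_ac cos_int_2pin)
  with i show ?thesis by (rule that)
qed

text \<open>
  A nonreal \<open>w\<close> in the range of branch \<open>0\<close> whose image is real must have
  \<open>Im w + Arg w = pi\<close>: the value \<open>0\<close> is excluded because \<open>Im w\<close> and \<open>Arg w\<close> have the same
  sign.  Then the image lies below \<open>- 1/e\<close>, the minimum of \<open>x * exp x\<close> on the reals.
\<close>

lemma lambert_W_0_real:
  assumes "-1 \<le> x"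
  shows "lambert_W 0 (complex_of_real (x * exp x)) = of_real x"
  unfolding lambert_W_def
proof (rule the_equality)
  show "complex_of_real x \<in> lambert_W_range 0 \<and>
        complex_of_real x * exp (complex_of_real x) = complex_of_real (x * exp x)"
    using assms by (auto simp: lambert_W_range_def Let_def exp_of_real)
next
  fix w assume "w \<in> lambert_W_range 0 \<and> w * exp w = complex_of_real (x * exp x)"
  hence r: "w \<in> lambert_W_range 0" and e: "w * exp w = complex_of_real (x * exp x)" by auto
  have sum: "- pi < Im w + Arg w" "Im w + Arg w \<le> pi" and nr: "\<not> (Im w = 0 \<and> Re w < -1)"
    using r by (auto simp: lambert_W_range_def Let_def)
  have "Im w = 0"
  proof (rule ccontr)
    assume im: "Im w \<noteq> 0"
    hence "w \<noteq> 0" by auto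
    then obtain i :: int where i: "Im w + Arg w = of_int i * pi"
      using real_preimage_unwrapped_arg[OF e] by metis
    have "real_of_int i * pi > (-1) * pi" "real_of_int i * pi \<le> 1 * pi" using sum i by auto
    hence "real_of_int i > -1" "real_of_int i \<le> 1"
      by (simp_all only: mult_less_cancel_right_pos mult_le_cancel_right_pos pi_gt_zero)
    hence "i = 0 \<or> i = 1" by linarith
    moreover have "i \<noteq> 0"
      using i im Arg_neg_iff[of w] Arg_lt_pi[of w] by (cases "Im w > 0") auto
    ultimately have "\<bar>Im w + Arg w\<bar> = pi" using i by simp
    from cut_preimage[OF im this] e x_exp_x_ge[of x] show False by simp
  qed
  then obtain u where u: "w = of_real u" by (metis complex_is_Real_iff Reals_cases)
  have "complex_of_real (u * exp u) = of_real (x * exp x)" using e u by (simp add: exp_of_real)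
  hence "u * exp u = x * exp x" by (simp only: of_real_eq_iff)
  moreover have "-1 \<le> u" using nr u by simp
  ultimately show "w = of_real x" using x_exp_x_inj_ge[of u x] assms u by simp
qed

text \<open>
  Here the unwrapped argument lies in \<open>(- 3 * pi, - pi]\<close>.  Of its multiples of \<open>pi\<close>,
  \<open>- 2 * pi\<close> would make the image positive, and \<open>- pi\<close> puts it below \<open>- 1/e\<close>.
\<close>

lemma lambert_W_m1_real:
  assumes "x \<le> -1"
  shows "lambert_W (-1) (complex_of_real (x * exp x)) = of_real x"
  unfolding lambert_W_def
proof (rule the_equality)
  show "complex_of_real x \<in> lambert_W_range (-1) \<and>
        complex_of_real x * exp (complex_of_real x) = complex_of_real (x * exp x)"
    using assms by (auto simp: lambert_W_range_def Let_def exp_of_real)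
next
  fix w assume "w \<in> lambert_W_range (-1) \<and> w * exp w = complex_of_real (x * exp x)"
  hence r: "w \<in> lambert_W_range (-1)" and e: "w * exp w = complex_of_real (x * exp x)" by auto
  have "x < 0" using assms by simp
  hence neg: "x * exp x < 0" by (simp add: mult_neg_pos)
  have *: "Im w = 0 \<and> Re w \<le> -1"
  proof (rule ccontr)
    assume nr: "\<not> (Im w = 0 \<and> Re w \<le> -1)"
    with r have sum: "- 3 * pi < Im w + Arg w" "Im w + Arg w \<le> - pi"
      by (auto simp: lambert_W_range_def Let_def)
    have im: "Im w \<noteq> 0" using sum mpi_less_Arg[of w] by auto
    hence "w \<noteq> 0" by auto
    then obtain i :: int where i: "Im w + Arg w = of_int i * pi" and ev: "even i \<Longrightarrow> x * exp x > 0"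
      using real_preimage_unwrapped_arg[OF e] by metis
    have "real_of_int i * pi > (-3) * pi" "real_of_int i * pi \<le> (-1) * pi" using sum i by auto
    hence "real_of_int i > -3" "real_of_int i \<le> -1"
      by (simp_all only: mult_less_cancel_right_pos mult_le_cancel_right_pos pi_gt_zero)
    hence "i = -1 \<or> i = -2" by linarith
    moreover have "odd i" using ev neg by linarith
    ultimately have "\<bar>Im w + Arg w\<bar> = pi" using i by auto
    from cut_preimage[OF im this] e x_exp_x_ge[of x] show False by simp
  qed
  then obtain u where u: "w = of_real u" by (metis complex_is_Real_iff Reals_cases)
  have "complex_of_real (u * exp u) = of_real (x * exp x)" using e u by (simp add: exp_of_real)
  hence "u * exp u = x * exp x" by (simp only: of_real_eq_iff)
  moreover have "u \<le> -1" using * u by simp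
  ultimately show "w = of_real x" using x_exp_x_inj_le[of u x] assms u by simp
qed

text \<open>
  The inverse function theorem provides a germ, which is needed to know anything about the
  chosen one; differentiating \<open>g u * exp (g u) = u\<close> then determines its derivative.
\<close>

lemma lambert_W_deriv_1:
  assumes "lambert_W k z * exp (lambert_W k z) = z" "lambert_W k z \<noteq> -1"
  shows "lambert_W_deriv k 1 z = 1 / ((1 + lambert_W k z) * exp (lambert_W k z))"
proof -
  define w where "w = lambert_W k z"
  define f where "f = (\<lambda>w::complex. w * exp w)"
  have df: "(f has_field_derivative (1 + v) * exp v) (at v)" for v
    unfolding f_def by (auto intro!: derivative_eq_intros simp: algebra_simps)
  have hol: "f holomorphic_on UNIV" unfolding f_def by (intro holomorphic_intros)
  have fw: "f w = z" using assms by (simp add: f_def w_def)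
  have nz: "(1 + w) * exp w \<noteq> 0" using assms(2) by (auto simp: w_def add_eq_0_iff)
  hence "deriv f w \<noteq> 0" using df[of w] by (simp add: DERIV_imp_deriv)
  then obtain r where r: "r > 0" "open (f ` ball w r)" "inj_on f (ball w r)"
    using has_complex_derivative_locally_invertible[OF hol, of w] by auto
  obtain h where h: "h holomorphic_on f ` ball w r" "\<And>v. v \<in> ball w r \<Longrightarrow> h (f v) = v"
    using holomorphic_has_inverse[OF holomorphic_on_subset[OF hol subset_UNIV] open_ball r(3)] by metis
  have "\<exists>U. open U \<and> z \<in> U \<and> h holomorphic_on U \<and> h z = lambert_W k z \<and>
                  (\<forall>u\<in>U. h u * exp (h u) = u)"
  proof (intro exI[of _ "f ` ball w r"] conjI ballI)
    show "z \<in> f ` ball w r" using fw r(1) by force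
    show "h z = lambert_W k z" using h(2)[of w] r(1) fw by (simp add: w_def)
    show "h u * exp (h u) = u" if "u \<in> f ` ball w r" for u
      using that h(2) by (force simp: f_def)
  qed (use r h in auto)
  from someI[where P = "\<lambda>g. \<exists>U. open U \<and> z \<in> U \<and> g holomorphic_on U \<and> g z = lambert_W k z \<and>
                  (\<forall>u\<in>U. g u * exp (g u) = u)", OF this, folded lambert_W_germ_def]
  obtain g U where g: "g = lambert_W_germ k z" and U: "open U" "z \<in> U" and
    gh: "g holomorphic_on U" and gz: "g z = w" and inv: "\<And>u. u \<in> U \<Longrightarrow> f (g u) = u"
    unfolding f_def w_def by blast
  have dg: "(g has_field_derivative deriv g z) (at z)"
    using holomorphic_derivI[OF gh U] .
  have "((\<lambda>u. f (g u)) has_field_derivative ((1 + w) * exp w) * deriv g z) (at z)"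
    using DERIV_chain2[OF _ dg, of f] df[of "g z"] gz by simp
  moreover have "((\<lambda>u. f (g u)) has_field_derivative 1) (at z)"
    by (rule has_field_derivative_transform_within_open[OF DERIV_ident U]) (simp add: inv)
  ultimately have "((1 + w) * exp w) * deriv g z = 1" by (rule DERIV_unique)
  thus ?thesis using nz unfolding g w_def[symmetric]
    by (simp add: lambert_W_deriv_def field_simps)
qed

lemma lambert_W_0_0: "lambert_W 0 0 = 0"
  using lambert_W_0_real[of 0] by simp

lemma lambert_W_deriv_0_0: "lambert_W_deriv 0 1 0 = 1"
  by (subst lambert_W_deriv_1) (simp_all add: lambert_W_0_0)

section \<open>Two by two matrices and their exponential\<close>

abbreviation mat2 :: "'a \<Rightarrow> 'a \<Rightarrow> 'a \<Rightarrow> 'a \<Rightarrow> 'a mat" where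
  "mat2 a b c d \<equiv> mat_of_rows_list 2 [[a, b], [c, d]]"

lemma mat2_carrier [simp]: "mat2 a b c d \<in> carrier_mat 2 2"
  and mat2_dim [simp]: "dim_row (mat2 a b c d) = 2" "dim_col (mat2 a b c d) = 2"
  and mat2_index [simp]: "mat2 a b c d $$ (0, 0) = a" "mat2 a b c d $$ (0, Suc 0) = b"
    "mat2 a b c d $$ (Suc 0, 0) = c" "mat2 a b c d $$ (Suc 0, Suc 0) = d"
  by (auto simp: mat_of_rows_list_def numeral_2_eq_2)

lemma eq_mat2I:
  assumes "X \<in> carrier_mat 2 2" "X $$ (0, 0) = a" "X $$ (0, Suc 0) = b"
    "X $$ (Suc 0, 0) = c" "X $$ (Suc 0, Suc 0) = d"
  shows "X = mat2 a b c d"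
  by (rule eq_matI) (use assms in \<open>auto simp: less_2_cases_iff\<close>)

lemma lessThan_2_eq: "{0..<2::nat} = {0, Suc 0}" "{..<2::nat} = {0, Suc 0}"
  by auto

lemma mat2_mult [simp]: "mat2 a b c d * mat2 e f g h =
    mat2 (a * e + b * g) (a * f + b * h) (c * e + d * g) (c * f + d * (h :: 'a :: comm_semiring_0))"
  by (rule eq_mat2I) (auto simp: scalar_prod_def lessThan_2_eq)

lemma mat2_add [simp]: "mat2 a b c d + mat2 e f g h = mat2 (a + e) (b + f) (c + g) (d + h)"
  by (rule eq_mat2I) auto

lemma mat2_diff [simp]: "mat2 a b c d - mat2 e f g h = mat2 (a - e) (b - f) (c - g) (d - h)"
  by (rule eq_mat2I) (auto intro!: minus_carrier_mat)

lemma mat2_smult [simp]: "r \<cdot>\<^sub>m mat2 a b c d = mat2 (r * a) (r * b) (r * c) (r * d)"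
  by (rule eq_mat2I) auto

lemma mat2_map [simp]: "map_mat f (mat2 a b c d) = mat2 (f a) (f b) (f c) (f d)"
  by (rule eq_mat2I) auto

lemma mat2_one: "1\<^sub>m 2 = mat2 1 0 0 1"
  by (rule eq_mat2I) auto

lemma mat2_zero: "0\<^sub>m 2 2 = mat2 0 0 0 0"
  by (rule eq_mat2I) auto

lemma det_mat2: "Determinant.det (mat2 a b c d) = a * d - b * (c :: 'a :: comm_ring_1)"
proof -
  have "Determinant.det (mat2 a b c d) = (\<Sum>j<2. mat2 a b c d $$ (0, j) * cofactor (mat2 a b c d) 0 j)"
    by (rule laplace_expansion_row) auto
  also have "\<dots> = a * d - b * c"
    by (simp add: lessThan_2_eq cofactor_def det_single mat_delete_def)
  finally show ?thesis .
qed

text \<open>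
  The eigenvector is \<open>(1, \<mu>)\<close>.
\<close>

lemma mat2_eigenvalue_companion:
  assumes "\<mu>\<^sup>2 = s1 + s2 * (\<mu> :: 'a :: comm_ring_1)"
  shows "eigenvalue (mat2 0 1 s1 s2) \<mu>"
  unfolding eigenvalue_def eigenvector_def
proof (intro exI conjI)
  let ?v = "vec 2 (\<lambda>i. if i = 0 then 1 else \<mu>)"
  show "?v \<in> carrier_vec (dim_row (mat2 0 1 s1 s2))" by simp
  show "?v \<noteq> 0\<^sub>v (dim_row (mat2 0 1 s1 s2))"
  proof
    assume "?v = 0\<^sub>v (dim_row (mat2 0 1 s1 s2))"
    from arg_cong[OF this, of "\<lambda>v. vec_index v 0"] show False by simp
  qed
  show "mat2 0 1 s1 s2 *\<^sub>v ?v = \<mu> \<cdot>\<^sub>v ?v"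
    using assms by (intro eq_vecI)
      (auto simp: less_2_cases_iff scalar_prod_def lessThan_2_eq power2_eq_square)
qed

text \<open>
  Sylvester's formula for a matrix with distinct eigenvalues \<open>\<mu>\<close> and \<open>\<nu>\<close>, given through
  trace and determinant: \<open>X - \<nu>\<close> and \<open>X - \<mu>\<close> are, up to the factor \<open>\<plusminus>(\<mu> - \<nu>)\<close>, the spectral
  projections, by the Cayley-Hamilton theorem.
\<close>

lemma mat2_pow:
  fixes a b c d \<mu> \<nu> :: "'a :: field"
  assumes ne: "\<mu> \<noteq> \<nu>" and tr: "a + d = \<mu> + \<nu>" and det: "a * d - b * c = \<mu> * \<nu>"
  shows "mat2 a b c d ^\<^sub>m m =
    (1 / (\<mu> - \<nu>)) \<cdot>\<^sub>m mat2 (\<mu> ^ m * (a - \<nu>) - \<nu> ^ m * (a - \<mu>)) (\<mu> ^ m * b - \<nu> ^ m * b)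
                          (\<mu> ^ m * c - \<nu> ^ m * c) (\<mu> ^ m * (d - \<nu>) - \<nu> ^ m * (d - \<mu>))"
proof (induction m)
  case 0
  show ?case using ne by (simp add: mat2_one diff_divide_distrib[symmetric])
next
  case (Suc m)
  have d: "d = \<mu> + \<nu> - a" using tr by (simp add: algebra_simps)
  have bc: "b * c = a * d - \<mu> * \<nu>" using det by (simp add: algebra_simps)
  have *: "(x * (a - \<nu>) - y * (a - \<mu>)) * a + (x * b - y * b) * c
        = x * \<mu> * (a - \<nu>) - y * \<nu> * (a - \<mu>)" for x y
  proof -
    have "(x * (a - \<nu>) - y * (a - \<mu>)) * a + (x * b - y * b) * c =
        (x * (a - \<nu>) - y * (a - \<mu>)) * a + (x - y) * (b * c)"
      by (simp add: algebra_simps)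
    thus ?thesis unfolding bc d by (simp add: algebra_simps)
  qed
  have **: "(x * c - y * c) * b + (x * (d - \<nu>) - y * (d - \<mu>)) * d
        = x * \<mu> * (d - \<nu>) - y * \<nu> * (d - \<mu>)" for x y
  proof -
    have "(x * c - y * c) * b + (x * (d - \<nu>) - y * (d - \<mu>)) * d =
        (x - y) * (b * c) + (x * (d - \<nu>) - y * (d - \<mu>)) * d"
      by (simp add: algebra_simps)
    thus ?thesis unfolding bc d by (simp add: algebra_simps)
  qed
  have ***:
     "(x * (a - \<nu>) - y * (a - \<mu>)) * b + (x * b - y * b) * d = x * \<mu> * b - y * \<nu> * b"
     "(x * c - y * c) * a + (x * (d - \<nu>) - y * (d - \<mu>)) * c = x * \<mu> * c - y * \<nu> * c" for x y
    unfolding d by (simp_all add: algebra_simps)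
  have factor: "r * u * e + r * v * f = r * (u * e + v * f)" for r u v e f :: 'a
    by (simp add: algebra_simps)
  show ?case
    unfolding pow_mat.simps Suc mat2_smult mat2_mult power_Suc2 factor * ** *** ..
qed

lemma exp_series_comb:
  fixes \<mu> \<nu> p q r :: complex
  shows "(\<Sum>m. r * (\<mu> ^ m * p - \<nu> ^ m * q) / fact m) = r * (exp \<mu> * p - exp \<nu> * q)"
proof -
  have e: "(\<lambda>m. z ^ m / fact m) sums exp z" for z :: complex
    using exp_converges[of z] by (simp add: scaleR_conv_of_real field_simps)
  have "(\<lambda>m. r * (\<mu> ^ m / fact m * p - \<nu> ^ m / fact m * q)) sums (r * (exp \<mu> * p - exp \<nu> * q))"
    by (intro sums_mult sums_diff sums_mult2 e)
  moreover have "(\<lambda>m. r * (\<mu> ^ m / fact m * p - \<nu> ^ m / fact m * q)) =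
      (\<lambda>m. r * (\<mu> ^ m * p - \<nu> ^ m * q) / fact m)"
    by (simp add: field_simps)
  ultimately show ?thesis by (simp add: sums_iff)
qed

lemma mat_exp_mat2:
  assumes "\<mu> \<noteq> \<nu>" "a + d = \<mu> + \<nu>" "a * d - b * c = \<mu> * \<nu>"
  shows "mat_exp (mat2 a b c d) =
    (1 / (\<mu> - \<nu>)) \<cdot>\<^sub>m mat2 (exp \<mu> * (a - \<nu>) - exp \<nu> * (a - \<mu>)) (exp \<mu> * b - exp \<nu> * b)
                          (exp \<mu> * c - exp \<nu> * c) (exp \<mu> * (d - \<nu>) - exp \<nu> * (d - \<mu>))"
proof -
  define r where "r = 1 / (\<mu> - \<nu>)"
  note pow = mat2_pow[OF assms, folded r_def, unfolded mat2_smult]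
  show ?thesis
    unfolding mat_exp_def r_def[symmetric] mat2_smult
    by (rule eq_mat2I) (simp_all add: pow exp_series_comb)
qed

text \<open>
  The vectors \<open>(1, \<mu>)\<close> and \<open>(1, \<nu>)\<close> form a basis of eigenvectors of the companion matrix, and
  hence of its exponential.  The matrix equation for the bottom rows therefore reduces to its two
  scalar instances on this basis.
\<close>

lemma bottom_row_mult_exp_companion:
  fixes \<mu> \<nu> t w1 w2 b1 b2 :: complex
  assumes "\<mu> \<noteq> \<nu>" "t \<noteq> 0"
    and \<mu>: "(w1 + w2 * \<mu>) * exp (t * \<mu>) = b1 + b2 * \<mu>"
    and \<nu>: "(w1 + w2 * \<nu>) * exp (t * \<nu>) = b1 + b2 * \<nu>"
  shows "mat2 0 0 w1 w2 * mat_exp (t \<cdot>\<^sub>m mat2 0 1 (- (\<mu> * \<nu>)) (\<mu> + \<nu>)) = mat2 0 0 b1 b2"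
proof -
  define e f where "e = exp (t * \<mu>)" and "f = exp (t * \<nu>)"
  have ne: "t * \<mu> - t * \<nu> \<noteq> 0" using assms(1,2) by simp
  have E: "mat_exp (t \<cdot>\<^sub>m mat2 0 1 (- (\<mu> * \<nu>)) (\<mu> + \<nu>)) =
      (1 / (t * \<mu> - t * \<nu>)) \<cdot>\<^sub>m mat2 (e * (t * 0 - t * \<nu>) - f * (t * 0 - t * \<mu>)) (e * (t * 1) - f * (t * 1))
        (e * (t * - (\<mu> * \<nu>)) - f * (t * - (\<mu> * \<nu>)))
        (e * (t * (\<mu> + \<nu>) - t * \<nu>) - f * (t * (\<mu> + \<nu>) - t * \<mu>))"
    unfolding e_def f_def mat2_smult[of t]
    by (rule mat_exp_mat2) (use assms(1,2) in \<open>auto simp: algebra_simps\<close>)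
  have "w1 * (e * (t * 0 - t * \<nu>) - f * (t * 0 - t * \<mu>)) +
      w2 * (e * (t * - (\<mu> * \<nu>)) - f * (t * - (\<mu> * \<nu>))) =
      t * (\<mu> * ((w1 + w2 * \<nu>) * f) - \<nu> * ((w1 + w2 * \<mu>) * e))"
    by (simp add: algebra_simps)
  also have "\<dots> = b1 * (t * \<mu> - t * \<nu>)"
    unfolding e_def f_def \<mu> \<nu> by (simp add: algebra_simps)
  finally have col1: "w1 * (e * (t * 0 - t * \<nu>) - f * (t * 0 - t * \<mu>)) +
      w2 * (e * (t * - (\<mu> * \<nu>)) - f * (t * - (\<mu> * \<nu>))) = b1 * (t * \<mu> - t * \<nu>)" .
  have "w1 * (e * (t * 1) - f * (t * 1)) +
      w2 * (e * (t * (\<mu> + \<nu>) - t * \<nu>) - f * (t * (\<mu> + \<nu>) - t * \<mu>)) =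
      t * ((w1 + w2 * \<mu>) * e - (w1 + w2 * \<nu>) * f)"
    by (simp add: algebra_simps)
  also have "\<dots> = b2 * (t * \<mu> - t * \<nu>)"
    unfolding e_def f_def \<mu> \<nu> by (simp add: algebra_simps)
  finally have col2: "w1 * (e * (t * 1) - f * (t * 1)) +
      w2 * (e * (t * (\<mu> + \<nu>) - t * \<nu>) - f * (t * (\<mu> + \<nu>) - t * \<mu>)) = b2 * (t * \<mu> - t * \<nu>)" .
  have cancel: "w1 * (1 / d * x) + w2 * (1 / d * y) = v"
    if "w1 * x + w2 * y = v * d" "d \<noteq> 0" for x y v d :: complex
    using that by (simp add: field_simps)
  show ?thesis
    unfolding E mat2_smult[of "1 / _"] mat2_mult cancel[OF col1 ne] cancel[OF col2 ne] by simp
qed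

section \<open>Jordan blocks under the equation H * H = t * H\<close>

lemma four_block_mat_diag_eq:
  assumes "A \<in> carrier_mat n n" "A' \<in> carrier_mat n n" "D \<in> carrier_mat m m" "D' \<in> carrier_mat m m"
    and eq: "four_block_mat A (0\<^sub>m n m) (0\<^sub>m m n) D = four_block_mat A' (0\<^sub>m n m) (0\<^sub>m m n) D'"
  shows "A = A'" "D = D'"
proof -
  have e: "four_block_mat A (0\<^sub>m n m) (0\<^sub>m m n) D $$ (i, j) =
      four_block_mat A' (0\<^sub>m n m) (0\<^sub>m m n) D' $$ (i, j)" for i j using eq by simp
  show "A = A'"
  proof (rule eq_matI)
    show "A $$ (i, j) = A' $$ (i, j)" if "i < dim_row A'" "j < dim_col A'" for i j
      using e[of i j] that assms(1-4) by auto
  qed (use assms in auto)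
  show "D = D'"
  proof (rule eq_matI)
    show "D $$ (i, j) = D' $$ (i, j)" if "i < dim_row D'" "j < dim_col D'" for i j
      using e[of "n + i" "n + j"] that assms(1-4) by auto
  qed (use assms in auto)
qed

lemma jordan_matrix_square_block:
  assumes "jordan_matrix n_as * jordan_matrix n_as = t \<cdot>\<^sub>m jordan_matrix n_as" "(n, a) \<in> set n_as"
  shows "jordan_block n a * jordan_block n a = t \<cdot>\<^sub>m jordan_block n (a :: 'a :: comm_ring_1)"
  using assms
proof (induction n_as)
  case (Cons na n_as)
  obtain k b where na: "na = (k, b)" by (cases na)
  let ?s = "sum_list (map fst n_as)"
  let ?J = "jordan_matrix n_as" and ?B = "jordan_block k b"
  have "jordan_matrix (na # n_as) * jordan_matrix (na # n_as) =
      four_block_mat (?B * ?B) (0\<^sub>m k ?s) (0\<^sub>m ?s k) (?J * ?J)"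
    unfolding na jordan_matrix_Cons by (subst mult_four_block_mat[of _ k k _ ?s _ ?s _ _ k _ ?s]) auto
  moreover have "t \<cdot>\<^sub>m jordan_matrix (na # n_as) =
      four_block_mat (t \<cdot>\<^sub>m ?B) (0\<^sub>m k ?s) (0\<^sub>m ?s k) (t \<cdot>\<^sub>m ?J)"
    unfolding na jordan_matrix_Cons by (subst smult_four_block_mat[of _ k k _ ?s _ ?s]) auto
  ultimately have "four_block_mat (?B * ?B) (0\<^sub>m k ?s) (0\<^sub>m ?s k) (?J * ?J) =
      four_block_mat (t \<cdot>\<^sub>m ?B) (0\<^sub>m k ?s) (0\<^sub>m ?s k) (t \<cdot>\<^sub>m ?J)"
    using Cons.prems(1) by simp
  from four_block_mat_diag_eq[OF _ _ _ _ this]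
  have "?B * ?B = t \<cdot>\<^sub>m ?B" "?J * ?J = t \<cdot>\<^sub>m ?J"
    by (metis jordan_block_carrier jordan_matrix_carrier mult_carrier_mat smult_carrier_mat)+
  with Cons show ?case by (auto simp: na)
qed simp

text \<open>
  The first three entries of the top row of the square decide: they are \<open>a\<^sup>2\<close>, \<open>2 * a\<close> and \<open>1\<close>,
  and have to equal \<open>t * a\<close>, \<open>t\<close> and \<open>0\<close>.
\<close>

lemma jordan_block_square_eq:
  assumes "jordan_block n a * jordan_block n a = t \<cdot>\<^sub>m jordan_block n (a :: 'a :: field_char_0)" "n \<noteq> 0"
  shows "n = 1 \<and> (a = 0 \<or> a = t) \<or> n = 2 \<and> a = 0 \<and> t = 0"
proof -
  have sq: "jordan_block n a ^\<^sub>m 2 = t \<cdot>\<^sub>m jordan_block n a"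
    using assms(1) by (simp add: numeral_2_eq_2 jordan_block_def)
  have e: "(if i \<le> j then of_nat (2 choose (j - i)) * a ^ (2 + i - j) else 0) =
     t * (if i = j then a else if Suc i = j then 1 else 0)" if "i < n" "j < n" for i j
    using arg_cong[OF sq, of "\<lambda>X. X $$ (i, j)"] that by (simp add: jordan_block_pow)
  have 0: "a = 0 \<or> a = t" using e[of 0 0] assms(2) by (auto simp: power2_eq_square)
  have 1: "2 * a = t" if "n \<ge> 2" using e[of 0 1] that by simp
  have 2: False if "n \<ge> 3" using e[of 0 2] that by simp
  show ?thesis using 0 1 2 assms(2) by (cases "n = 1") force+
qed

lemma similar_mat_wit_square_eq:
  assumes "H * H = t \<cdot>\<^sub>m H" "similar_mat_wit H J P (Q :: 'a :: comm_ring_1 mat)"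
  shows "J * J = t \<cdot>\<^sub>m J"
proof -
  obtain n where n: "n = dim_row H" by simp
  note D = similar_mat_witD[OF n assms(2)]
  note S = similar_mat_witD[OF _ similar_mat_wit_sym[OF assms(2)], of n]
  have J: "J = Q * H * P" using S(3) D by auto
  have "H ^\<^sub>m 2 = t \<cdot>\<^sub>m H" using assms(1) D(4) by (simp add: numeral_2_eq_2)
  moreover have "J ^\<^sub>m 2 = Q * H ^\<^sub>m 2 * P"
    using similar_mat_witD(3)[OF _ similar_mat_wit_pow[OF similar_mat_wit_sym[OF assms(2)]], of n 2] D
    by auto
  ultimately have "J ^\<^sub>m 2 = Q * (t \<cdot>\<^sub>m H) * P" by simp
  also have "\<dots> = t \<cdot>\<^sub>m J"
    unfolding J using D(4,6,7) by (simp add: mult_smult_distrib[of Q n n H n] mult_smult_assoc_mat[of "Q * H" n n P n])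
  finally show ?thesis using D(5) by (simp add: numeral_2_eq_2)
qed

lemma jordan_matrix_square_eq_cases:
  assumes "H * H = t \<cdot>\<^sub>m H" "similar_mat_wit H (jordan_matrix n_as) P Q"
    "0 \<notin> fst ` set n_as" "(n, a :: 'a :: field_char_0) \<in> set n_as"
  shows "n = 1 \<and> (a = 0 \<or> a = t) \<or> n = 2 \<and> a = 0 \<and> t = 0"
proof (rule jordan_block_square_eq)
  show "jordan_block n a * jordan_block n a = t \<cdot>\<^sub>m jordan_block n a"
    using jordan_matrix_square_block[OF similar_mat_wit_square_eq[OF assms(1,2)] assms(4)] .
  show "n \<noteq> 0" using assms(3,4) by force
qed

lemma diag_block_mat_smult:
  "diag_block_mat (map (\<lambda>A. c \<cdot>\<^sub>m A) As) = c \<cdot>\<^sub>m diag_block_mat (As :: 'a :: comm_ring_1 mat list)"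
proof (induction As)
  case (Cons A As)
  have d: "diag_block_mat As \<in> carrier_mat (dim_row (diag_block_mat As)) (dim_col (diag_block_mat As))"
    "A \<in> carrier_mat (dim_row A) (dim_col A)"
    by auto
  show ?case using Cons
    by (simp add: Let_def smult_four_block_mat[OF d(2) _ _ d(1)])
qed auto

lemma ex_jordan_decomposition:
  assumes "H \<in> carrier_mat n n"
  shows "\<exists>D. jordan_decomposition H D"
proof -
  obtain as where "char_poly H = (\<Prod>a\<leftarrow>as. [:- a, 1:])"
    using char_poly_factorized[OF assms] by auto
  from jordan_nf_exists[OF assms this] obtain n_as Z Zi where
    "0 \<notin> fst ` set n_as" "similar_mat_wit H (jordan_matrix n_as) Z Zi"
    unfolding jordan_nf_def similar_mat_def by auto
  hence "jordan_decomposition H (Z, Zi, n_as)" by (simp add: jordan_decomposition_def)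
  thus ?thesis ..
qed

section \<open>Matrix Lambert W function on real bottom rows\<close>

text \<open>
  A matrix of rank at most one satisfies \<open>H * H = t * H\<close> with \<open>t\<close> its trace.  Because the
  hybrid convention gives the value \<open>0\<close> at the eigenvalue \<open>0\<close>, the scalar function agrees with the
  linear map \<open>z \<mapsto> c * z\<close> on both possible eigenvalues \<open>0\<close> and \<open>t\<close>; on a nilpotent block of size
  two, which occurs only for \<open>t = 0\<close>, it agrees with the identity to first order since
  \<open>W\<^sub>0'(0) = 1\<close>.  So the value is \<open>c * H\<close> for every Jordan decomposition of \<open>H\<close>, in particular for
  the one chosen in the definition.
\<close>

lemma matrix_lambert_W_eq_smult:
  assumes H: "H \<in> carrier_mat n n" and sq: "H * H = t \<cdot>\<^sub>m H"
    and t: "t \<noteq> 0 \<Longrightarrow> lambert_W k t = c * t" and t0: "t = 0 \<Longrightarrow> c = 1"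
  shows "matrix_lambert_W k H = c \<cdot>\<^sub>m H"
proof -
  obtain Z Zi n_as where D: "(SOME D. jordan_decomposition H D) = (Z, Zi, n_as)"
    by (cases "SOME D. jordan_decomposition H D") auto
  have "jordan_decomposition H (Z, Zi, n_as)"
    using someI_ex[OF ex_jordan_decomposition[OF H]] unfolding D .
  hence pos: "0 \<notin> fst ` set n_as" and sim: "similar_mat_wit H (jordan_matrix n_as) Z Zi"
    by (auto simp: jordan_decomposition_def)
  note S = similar_mat_witD2[OF H sim]
  have block: "lambert_W_jordan_block k m a = c \<cdot>\<^sub>m jordan_block m a" if "(m, a) \<in> set n_as" for m a
    using jordan_matrix_square_eq_cases[OF sq sim pos that]
  proof (elim disjE conjE)
    assume "m = 1" "a = 0"
    thus ?thesis
      by (intro eq_matI) (auto simp: lambert_W_jordan_block_def lambert_W_deriv_def lambert_W_0_0)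
  next
    assume "m = 1" "a = t"
    thus ?thesis using t
      by (intro eq_matI) (auto simp: lambert_W_jordan_block_def lambert_W_deriv_def lambert_W_0_0)
  next
    assume m: "m = 2" "a = 0" and "t = 0"
    hence c: "c = 1" using t0 by simp
    have "lambert_W_deriv 0 0 0 = 0" by (simp add: lambert_W_deriv_def lambert_W_0_0)
    thus ?thesis unfolding m c using lambert_W_deriv_0_0
      by (intro eq_matI) (auto simp: lambert_W_jordan_block_def less_2_cases_iff)
  qed
  have "diag_block_mat (map (\<lambda>(m, a). lambert_W_jordan_block k m a) n_as) =
      diag_block_mat (map (\<lambda>A. c \<cdot>\<^sub>m A) (map (\<lambda>(m, a). jordan_block m a) n_as))"
    unfolding map_map using block by (intro arg_cong[of _ _ diag_block_mat] map_cong) auto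
  also have "\<dots> = c \<cdot>\<^sub>m jordan_matrix n_as"
    unfolding diag_block_mat_smult jordan_matrix_def ..
  finally have "matrix_lambert_W k H = Z * (c \<cdot>\<^sub>m jordan_matrix n_as) * Zi"
    unfolding matrix_lambert_W_def D by simp
  also have "\<dots> = c \<cdot>\<^sub>m (Z * jordan_matrix n_as * Zi)"
    using S(5-7) by (simp add: mult_smult_distrib[of Z n n _ n] mult_smult_assoc_mat[of _ n n Zi n])
  finally show ?thesis using S(3) by simp
qed

text \<open>
  Blocks of size at least two can only have the eigenvalue \<open>0\<close>, which is not the branch point.
\<close>

lemma matrix_lambert_W_defined_square:
  assumes sq: "H * H = t \<cdot>\<^sub>m H"
  shows "matrix_lambert_W_defined k H"
  unfolding matrix_lambert_W_defined_def
proof (intro impI allI, elim conjE)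
  fix n_as m assume "jordan_nf H n_as" and m: "(m, - exp (- 1)) \<in> set n_as"
  then obtain P Q where *: "0 \<notin> fst ` set n_as" "similar_mat_wit H (jordan_matrix n_as) P Q"
    by (auto simp: jordan_nf_def similar_mat_def)
  from jordan_matrix_square_eq_cases[OF sq *(2,1) m] show "m \<le> 1" by auto
qed

text \<open>
  Every real matrix with vanishing top row is a value of one of the two branches at a real
  argument.  The branch is chosen such that its real values include the eigenvalue \<open>w2\<close>.
\<close>

lemma matrix_lambert_W_bottom_row:
  fixes w1 w2 :: real
  defines "k \<equiv> if -1 \<le> w2 then 0 else -1 :: int"
  defines "M \<equiv> mat2 0 0 (exp w2 * w1) (exp w2 * w2)"
  shows "matrix_lambert_W k (cmat M) = cmat (mat2 0 0 w1 w2)"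
    and "matrix_lambert_W_defined k (cmat M)"
proof -
  have cM: "cmat M = mat2 0 0 (of_real (exp w2 * w1)) (of_real (exp w2 * w2))"
    by (simp add: M_def)
  have sq: "cmat M * cmat M = of_real (w2 * exp w2) \<cdot>\<^sub>m cmat M"
    unfolding cM by (simp add: mult_ac)
  have "matrix_lambert_W k (cmat M) = of_real (exp (- w2)) \<cdot>\<^sub>m cmat M"
  proof (rule matrix_lambert_W_eq_smult[OF _ sq])
    have c: "complex_of_real (exp (- w2)) * of_real (w2 * exp w2) = of_real w2"
      unfolding of_real_mult[symmetric] by (simp add: exp_minus)
    show "lambert_W k (of_real (w2 * exp w2)) = of_real (exp (- w2)) * of_real (w2 * exp w2)"
      unfolding c using lambert_W_0_real[of w2] lambert_W_m1_real[of w2] by (simp add: k_def)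
    assume "complex_of_real (w2 * exp w2) = 0"
    thus "complex_of_real (exp (- w2)) = 1" by simp
  qed (unfold cM, rule mat2_carrier)
  also have "\<dots> = cmat (mat2 0 0 w1 w2)"
    unfolding cM mat2_smult mat2_map of_real_mult[symmetric]
    by (simp add: exp_minus field_simps)
  finally show "matrix_lambert_W k (cmat M) = cmat (mat2 0 0 w1 w2)" .
  show "matrix_lambert_W_defined k (cmat M)" by (rule matrix_lambert_W_defined_square[OF sq])
qed

section \<open>Characteristic roots and the real solution belonging to a pair of them\<close>

lemma char_root_iff:
  assumes "A = mat2 0 1 a21 a22" "B = mat2 0 0 b21 b22"
  shows "char_root A B \<tau> s \<longleftrightarrow>
    s\<^sup>2 - of_real a22 * s - of_real a21 = exp (- s * of_real \<tau>) * (of_real b21 + of_real b22 * s)"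
  unfolding char_root_def char_fun_def assms
  by (simp add: mat2_one det_mat2) (auto simp: algebra_simps power2_eq_square)

lemma char_root_cnj:
  assumes "A = mat2 0 1 a21 a22" "B = mat2 0 0 b21 b22" "char_root A B \<tau> s"
  shows "char_root A B \<tau> (cnj s)"
proof -
  have "cnj (s\<^sup>2 - of_real a22 * s - of_real a21) =
      cnj (exp (- s * of_real \<tau>) * (of_real b21 + of_real b22 * s))"
    using assms(3) char_root_iff[OF assms(1,2)] by simp
  thus ?thesis using char_root_iff[OF assms(1,2)] by (simp add: exp_cnj)
qed

text \<open>
  A nonreal root is paired with its conjugate; a real root is paired with another real root,
  which exists by the hypothesis on their number.  That hypothesis is a statement about \<open>card\<close>, so
  it also admits an infinite set of real roots, of cardinality \<open>0\<close>, where a second one exists all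
  the more.
\<close>

lemma second_root:
  assumes AB: "A = mat2 0 1 a21 a22" "B = mat2 0 0 b21 b22"
   and card: "card {x :: real. char_root A B \<tau> (complex_of_real x)} \<noteq> 1"
   and \<mu>: "char_root A B \<tau> \<mu>"
  obtains \<nu> s p where "char_root A B \<tau> \<nu>" "\<mu> \<noteq> \<nu>" "\<mu> + \<nu> = complex_of_real s" "\<mu> * \<nu> = complex_of_real p"
proof (cases "\<mu> \<in> \<real>")
  case False
  show ?thesis
  proof
    show "char_root A B \<tau> (cnj \<mu>)" by (rule char_root_cnj[OF AB \<mu>])
    show "\<mu> \<noteq> cnj \<mu>" using False by (metis Reals_cnj_iff)
    show "\<mu> + cnj \<mu> = complex_of_real (2 * Re \<mu>)" by (simp add: complex_add_cnj)
    show "\<mu> * cnj \<mu> = complex_of_real ((Re \<mu>)\<^sup>2 + (Im \<mu>)\<^sup>2)" by (rule complex_mult_cnj)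
  qed
next
  case True
  then obtain x where x: "\<mu> = of_real x" by (auto elim: Reals_cases)
  let ?R = "{x :: real. char_root A B \<tau> (complex_of_real x)}"
  have "?R \<noteq> {x}" using card by auto
  moreover have "x \<in> ?R" using \<mu> x by simp
  ultimately obtain y where y: "y \<in> ?R" "y \<noteq> x" by blast
  show ?thesis
    by (rule that[of "of_real y" "x + y" "x * y"]) (use x y in auto)
qed

text \<open>
  The columns of the witness are multiples of \<open>(b1, b2)\<close>, so that the row \<open>(b1, b2)\<close> multiplies
  them to its own squared norm, which is then divided out.
\<close>

lemma bottom_row_factor:
  fixes \<tau> b1 b2 m1 m2 :: real
  assumes "\<tau> \<noteq> 0" "b1 = 0 \<and> b2 = 0 \<Longrightarrow> m1 = 0 \<and> m2 = 0"
  shows "\<exists>Q \<in> carrier_mat 2 2. mat2 0 0 m1 m2 = \<tau> \<cdot>\<^sub>m (mat2 0 0 b1 b2 * Q)"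
proof
  define c where "c = 1 / (\<tau> * (b1\<^sup>2 + b2\<^sup>2))"
  let ?Q = "mat2 (c * (b1 * m1)) (c * (b1 * m2)) (c * (b2 * m1)) (c * (b2 * m2))"
  show "?Q \<in> carrier_mat 2 2" by simp
  show "mat2 0 0 m1 m2 = \<tau> \<cdot>\<^sub>m (mat2 0 0 b1 b2 * ?Q)"
  proof (cases "b1 = 0 \<and> b2 = 0")
    case True
    thus ?thesis using assms(2) by simp
  next
    case False
    hence "b1\<^sup>2 + b2\<^sup>2 \<noteq> 0" by (simp add: sum_power2_eq_zero_iff)
    hence c: "\<tau> * c * (b1\<^sup>2 + b2\<^sup>2) = 1" using assms(1) by (simp add: c_def)
    have "\<tau> * (b1 * (c * (b1 * m)) + b2 * (c * (b2 * m))) = (\<tau> * c * (b1\<^sup>2 + b2\<^sup>2)) * m" for m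
      by (simp add: power2_eq_square algebra_simps)
    thus ?thesis using c by simp
  qed
qed

theorem corollary1:
  fixes \<tau> a21 a22 b21 b22 :: real and A B :: "real mat"
  assumes "\<tau> > 0"
    and "A = mat_of_rows_list 2 [[0, 1], [a21, a22]]"
    and "B = mat_of_rows_list 2 [[0, 0], [b21, b22]]"
    and "\<forall>s. char_root A B \<tau> s \<longrightarrow> simple_char_root A B \<tau> s"
    and "card {x :: real. char_root A B \<tau> (complex_of_real x)} \<noteq> 1"
  shows "\<forall>\<mu> :: complex. char_root A B \<tau> \<mu> \<longrightarrow>
    (\<exists>k \<in> {0, -1 :: int}. \<exists>M \<in> carrier_mat 2 2. \<exists>Q \<in> carrier_mat 2 2.
       M = \<tau> \<cdot>\<^sub>m (B * Q) \<and>
       matrix_lambert_W_defined k (cmat M) \<and>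
       (let W = matrix_lambert_W k (cmat M) in
          W * mat_exp (W + complex_of_real \<tau> \<cdot>\<^sub>m cmat A) - complex_of_real \<tau> \<cdot>\<^sub>m cmat B = 0\<^sub>m 2 2 \<and>
          eigenvalue (complex_of_real (1 / \<tau>) \<cdot>\<^sub>m W + cmat A) \<mu>))"
proof (intro allI impI)
  fix \<mu> assume \<mu>: "char_root A B \<tau> \<mu>"
  obtain \<nu> s p where \<nu>: "char_root A B \<tau> \<nu>" and ne: "\<mu> \<noteq> \<nu>"
    and s: "\<mu> + \<nu> = complex_of_real s" and p: "\<mu> * \<nu> = complex_of_real p"
    using second_root[OF assms(2,3,5) \<mu>] .
  define S where "S = mat2 0 1 (- p) s"
  \<comment> \<open>The bottom row of \<open>\<tau> * (S - A)\<close>; the top row vanishes.\<close>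
  define w1 w2 where "w1 = \<tau> * (- p - a21)" and "w2 = \<tau> * (s - a22)"
  define W where "W = cmat (mat2 0 0 w1 w2)"
  define k :: int where "k = (if -1 \<le> w2 then 0 else -1)"
  define M where "M = mat2 0 0 (exp w2 * w1) (exp w2 * w2)"

  have root: "(of_real w1 + of_real w2 * z) * exp (of_real \<tau> * z) =
      of_real (\<tau> * b21) + of_real (\<tau> * b22) * z"
    if z: "char_root A B \<tau> z" "z = \<mu> \<or> z = \<nu>" for z :: complex
  proof -
    have z2: "z\<^sup>2 = of_real s * z - of_real p"
      using z(2) unfolding s[symmetric] p[symmetric]
      by (auto simp: power2_eq_square algebra_simps)
    have "of_real w1 + of_real w2 * z = of_real \<tau> * (z\<^sup>2 - of_real a22 * z - of_real a21)"
      unfolding z2 by (simp add: w1_def w2_def algebra_simps)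
    also have "\<dots> = exp (- (of_real \<tau> * z)) * (of_real (\<tau> * b21) + of_real (\<tau> * b22) * z)"
      using z(1) by (simp add: char_root_iff[OF assms(2,3)] algebra_simps)
    finally show ?thesis by (simp add: exp_minus)
  qed

  have WA: "W + of_real \<tau> \<cdot>\<^sub>m cmat A = of_real \<tau> \<cdot>\<^sub>m cmat S"
    by (simp add: W_def S_def assms(2) w1_def w2_def algebra_simps)
  have cS: "cmat S = mat2 0 1 (- (\<mu> * \<nu>)) (\<mu> + \<nu>)"
    unfolding s p by (simp add: S_def)
  have "W * mat_exp (of_real \<tau> \<cdot>\<^sub>m cmat S) = mat2 0 0 (of_real (\<tau> * b21)) (of_real (\<tau> * b22))"
    unfolding W_def cS mat2_map of_real_0
    using bottom_row_mult_exp_companion[OF ne _ root[OF \<mu>] root[OF \<nu>]] assms(1) by simp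
  hence eq: "W * mat_exp (W + of_real \<tau> \<cdot>\<^sub>m cmat A) - of_real \<tau> \<cdot>\<^sub>m cmat B = 0\<^sub>m 2 2"
    unfolding WA by (simp add: assms(3) mat2_zero)

  have "\<mu>\<^sup>2 = of_real (- p) + of_real s * \<mu>"
    unfolding s[symmetric] of_real_minus p[symmetric] by (simp add: power2_eq_square algebra_simps)
  hence "eigenvalue (cmat S) \<mu>"
    unfolding S_def by (simp add: mat2_eigenvalue_companion)
  moreover have "complex_of_real (1 / \<tau>) \<cdot>\<^sub>m W + cmat A = cmat S"
    using assms(1) by (simp add: W_def S_def assms(2) w1_def w2_def)
  ultimately have ev: "eigenvalue (complex_of_real (1 / \<tau>) \<cdot>\<^sub>m W + cmat A) \<mu>" by simp

  \<comment> \<open>If \<open>B = 0\<close>, then \<open>\<mu>\<close> and \<open>\<nu>\<close> are the eigenvalues of \<open>A\<close>, so \<open>S = A\<close>.\<close>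
  have "w1 = 0 \<and> w2 = 0" if "b21 = 0 \<and> b22 = 0"
  proof -
    have zero: "of_real w1 + of_real w2 * \<mu> = 0" "of_real w1 + of_real w2 * \<nu> = 0"
      using root[OF \<mu>] root[OF \<nu>] that by auto
    have "of_real w2 * (\<mu> - \<nu>) = (of_real w1 + of_real w2 * \<mu>) - (of_real w1 + of_real w2 * \<nu>)"
      by (simp add: algebra_simps)
    hence "w2 = 0" using zero ne by simp
    thus ?thesis using zero by simp
  qed
  then obtain Q where Q: "Q \<in> carrier_mat 2 2" "M = \<tau> \<cdot>\<^sub>m (B * Q)"
    using bottom_row_factor[of \<tau> b21 b22 "exp w2 * w1" "exp w2 * w2"] assms(1)
    unfolding M_def assms(3) by auto

  show "(\<exists>k \<in> {0, -1 :: int}. \<exists>M \<in> carrier_mat 2 2. \<exists>Q \<in> carrier_mat 2 2.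
       M = \<tau> \<cdot>\<^sub>m (B * Q) \<and>
       matrix_lambert_W_defined k (cmat M) \<and>
       (let W = matrix_lambert_W k (cmat M) in
          W * mat_exp (W + complex_of_real \<tau> \<cdot>\<^sub>m cmat A) - complex_of_real \<tau> \<cdot>\<^sub>m cmat B = 0\<^sub>m 2 2 \<and>
          eigenvalue (complex_of_real (1 / \<tau>) \<cdot>\<^sub>m W + cmat A) \<mu>))"
  proof (rule bexI[of _ k], rule bexI[of _ M], rule bexI[of _ Q], intro conjI)
    show "M = \<tau> \<cdot>\<^sub>m (B * Q)" by (rule Q(2))
    show "matrix_lambert_W_defined k (cmat M)"
      unfolding k_def M_def by (rule matrix_lambert_W_bottom_row(2))
    have "matrix_lambert_W k (cmat M) = W"
      unfolding k_def M_def W_def by (rule matrix_lambert_W_bottom_row(1))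
    thus "let W = matrix_lambert_W k (cmat M) in
        W * mat_exp (W + complex_of_real \<tau> \<cdot>\<^sub>m cmat A) - complex_of_real \<tau> \<cdot>\<^sub>m cmat B = 0\<^sub>m 2 2 \<and>
        eigenvalue (complex_of_real (1 / \<tau>) \<cdot>\<^sub>m W + cmat A) \<mu>"
      using eq ev by simp
    show "M \<in> carrier_mat 2 2" "k \<in> {0, -1}" by (simp_all add: M_def k_def)
  qed (rule Q(1))
qed

end
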